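(* For $m\in\mathbb{N}$ and $n\in\mathbb{N}\cup\{0\}$, \[ 1^n+3^n+\cdots+(2m-1)^n=2^n\,\frac{b_{n+1}(m)-b_{n+1}}{n+1}. \]
   Context: The type 2 Bernoulli polynomials $b_n(x)$ are defined by $\frac{t}{e^{t/2}-e^{-t/2}}e^{xt}=\sum_{n\ge0}b_n(x)\frac{t^n}{n!}$, and $b_n=b_n(0)$. *)

theory Defs
  imports Complex_Main "HOL-Computational_Algebra.Formal_Power_Series"
begin

text \<open>
  The exponential generating functions are read as formal power series in \<open>t\<close>
  (\<open>fps_exp c\<close> is the series of \<open>e^{c t}\<close>). Numerator and denominator of
  \<open>t / (e^{t/2} - e^{-t/2})\<close> both have order 1, so the division of formal power
  series is exact; see \<open>type2_bernoulli_gf_mult\<close>.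
\<close>

definition type2_bernoulli_gf :: "real fps" where
  "type2_bernoulli_gf = fps_X / (fps_exp (1/2) - fps_exp (- (1/2)))"

definition type2_bernpoly :: "nat \<Rightarrow> real \<Rightarrow> real" where
  "type2_bernpoly n x = fact n * fps_nth (type2_bernoulli_gf * fps_exp x) n"

definition type2_bernoulli :: "nat \<Rightarrow> real" where
  "type2_bernoulli n = type2_bernpoly n 0"

lemma type2_bernoulli_gf_mult:
  "type2_bernoulli_gf * (fps_exp (1/2) - fps_exp (- (1/2))) = fps_X"
proof -
  let ?D = "fps_exp (1/2) - fps_exp (- (1/2)) :: real fps"
  have nz: "fps_nth ?D 1 \<noteq> 0" by simp
  then have "?D \<noteq> 0" by (metis fps_zero_nth)
  moreover have "subdegree ?D \<le> subdegree (fps_X :: real fps)"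
    using subdegree_leI[OF nz] by simp
  ultimately show ?thesis
    unfolding type2_bernoulli_gf_def by (simp add: fps_divide_times_eq fps_dvd_iff)
qed

lemma type2_bernpoly_egf:
  "Abs_fps (\<lambda>n. type2_bernpoly n x / fact n) = type2_bernoulli_gf * fps_exp x"
  by (rule fps_ext) (simp add: type2_bernpoly_def)

lemma type2_bernpoly_altdef:
  "type2_bernpoly n x = (\<Sum>k\<le>n. of_nat (n choose k) * type2_bernoulli k * x ^ (n - k))"
  by (auto simp: type2_bernpoly_def type2_bernoulli_def fps_mult_nth sum_distrib_left
      binomial_fact atLeast0AtMost intro!: sum.cong)

end

theory Submission imports Defs begin

text \<open>The sum telescopes. By \<open>type2_bernpoly_diff\<close>, raising the argument of
  b_{n+1} from k-1 to k adds (n+1) (k - 1/2)^n, and 2^n (k - 1/2)^n = (2k-1)^n. Summing over k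
  leaves b_{n+1}(m) - b_{n+1}(0), up to the factor 2^n / (n+1).\<close>

text \<open>Taking e^{(x+1/2)t} out of e^{(x+1)t} - e^{xt} leaves e^{t/2} - e^{-t/2}, exactly the
  denominator of the generating function. The difference thus has generating function t
  e^{(x+1/2)t}.\<close>

lemma type2_bernpoly_diff:
  "type2_bernpoly (Suc n) (x + 1) - type2_bernpoly (Suc n) x = real (Suc n) * (x + 1/2) ^ n"
proof -
  let ?E = "fps_exp :: real \<Rightarrow> real fps"
  have "?E (x + 1) = ?E (1/2) * ?E (x + 1/2)" "?E x = ?E (- (1/2)) * ?E (x + 1/2)"
    by (simp_all add: fps_exp_add_mult [symmetric] algebra_simps)
  then have "type2_bernoulli_gf * ?E (x + 1) - type2_bernoulli_gf * ?E x
      = type2_bernoulli_gf * (?E (1/2) - ?E (- (1/2))) * ?E (x + 1/2)"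
    by (simp only: algebra_simps)
  also have "\<dots> = fps_X * ?E (x + 1/2)"
    by (simp only: type2_bernoulli_gf_mult)
  \<comment> \<open>The factor \<open>fps_X\<close> shifts the index, so coefficient
    \<open>Suc n\<close> here is coefficient \<open>n\<close> of the exponential; multiplying by
    \<open>fact (Suc n)\<close> then leaves the factor \<open>Suc n\<close>.\<close>
  finally have "fps_nth (type2_bernoulli_gf * ?E (x + 1)) (Suc n)
      - fps_nth (type2_bernoulli_gf * ?E x) (Suc n) = (x + 1/2) ^ n / fact n"
    by (simp flip: fps_sub_nth)
  then show ?thesis
    unfolding type2_bernpoly_def right_diff_distrib [symmetric] by simp
qed

theorem theorem2p6:
  fixes m n :: nat
  assumes "m \<ge> 1"
  shows "(\<Sum>k=1..m. (2 * real k - 1) ^ n) =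
    2 ^ n * ((type2_bernpoly (n + 1) (real m) - type2_bernoulli (n + 1)) / real (n + 1))"
proof (induction m)
  case 0
  show ?case by (simp add: type2_bernoulli_def)
next
  case (Suc m)
  let ?b = "type2_bernpoly (n + 1)"
  \<comment> \<open>The new odd number is 2m + 1 = 2 (m + 1/2), which fits the difference equation
    at x = m.\<close>
  have "(2 * real (Suc m) - 1) ^ n = 2 ^ n * (real m + 1/2) ^ n"
    by (simp flip: power_mult_distrib add: algebra_simps)
  also have "\<dots> = 2 ^ n * ((?b (real (Suc m)) - ?b (real m)) / real (n + 1))"
    using type2_bernpoly_diff [of n "real m"] by (simp add: add.commute)
  finally have "(2 * real (Suc m) - 1) ^ n
      = 2 ^ n * ((?b (real (Suc m)) - ?b (real m)) / real (n + 1))" .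
  then have "(\<Sum>k=1..Suc m. (2 * real k - 1) ^ n)
      = 2 ^ n * ((?b (real m) - type2_bernoulli (n + 1)) / real (n + 1))
        + 2 ^ n * ((?b (real (Suc m)) - ?b (real m)) / real (n + 1))"
    using Suc.IH by simp
  \<comment> \<open>Over the common factor, the two terms in \<open>?b (real m)\<close>
    cancel.\<close>
  also have "\<dots> = 2 ^ n * ((?b (real (Suc m)) - type2_bernoulli (n + 1)) / real (n + 1))"
    by (simp only: distrib_left [symmetric] add_divide_distrib [symmetric]) simp
  finally show ?case .
qed

end
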